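(* Let $G$ be a finite group and let $S\subseteq G$ be a symmetric generating set of $G$ (i.e. $S=S^{-1}$) not containing the identity, closed under conjugation, with $|S|=d$. Suppose the Cayley sum graph $C_\Sigma(G,S)$ is an expander, and let $h(G)$ denote its vertex Cheeger constant. If $C_\Sigma(G,S)$ is non-bipartite, then $$\lambda_n<2-\frac{h(G)^4}{2^9d^8}\qquad(\text{equivalently } -1+\frac{h(G)^4}{2^9d^8}<t_n),$$ where $n=|G|$, $\lambda_n$ is the largest eigenvalue of the normalised Laplacian matrix and $t_n$ is the smallest eigenvalue of the normalised adjacency matrix of $C_\Sigma(G,S)$.
   Context: The Cayley sum graph $C_\Sigma(G,S)$ has vertex set $G$, and $h$ is adjacent to $g$ iff $h=g^{-1}s$ for some $s\in S$, i.e. iff $gh\in S$; since $S$ is closed under conjugation this relation is symmetric, so the graph is undirected (loops occur at $g$ when $g^2\in S$). It is $d$-regular: its adjacency matrix $A$ has $A_{g,h}=1$ if $gh\in S$ and $0$ otherwise, each row having exactly $d$ ones. The normalised adjacency matrix is $T=A/d$ (eigenvalues $t_1=1\ge t_2\ge\dots\ge t_n\ge -1$) and the normalised Laplacian is $L=I-T$ (eigenvalues $\lambda_i=1-t_i$). For $X\subseteq G$ the neighbourhood is $N(X)=X^{-1}S$ and the vertex boundary is $\delta(X)=N(X)\setminus X$. The vertex Cheeger constant is $h(G)=\min\{|\delta(X)|/|X|:\emptyset\ne X\subseteq G,\ |X|\le |G|/2\}$. The graph is an expander if $h(G)\ge\varepsilon$ for some $\varepsilon>0$. A graph is bipartite if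 its vertex set is a union of two disjoint sets each containing no edge (in particular no loop). *)

theory Defs
  imports
    "HOL-Algebra.Generated_Groups"
    "Jordan_Normal_Form.Spectral_Radius"
begin

definition cayley_sum_adj :: "('a, 'b) monoid_scheme \<Rightarrow> 'a set \<Rightarrow> 'a \<Rightarrow> 'a \<Rightarrow> bool" where
  "cayley_sum_adj G S g h \<longleftrightarrow> g \<otimes>\<^bsub>G\<^esub> h \<in> S"

lemma (in group) cayley_sum_adj_iff:
  assumes "S \<subseteq> carrier G" "g \<in> carrier G" "h \<in> carrier G"
  shows "cayley_sum_adj G S g h \<longleftrightarrow> (\<exists>s\<in>S. h = inv g \<otimes> s)"
  using assms unfolding cayley_sum_adj_def
  by (metis inv_solve_left subsetD)

definition cayley_sum_nbhd :: "('a, 'b) monoid_scheme \<Rightarrow> 'a set \<Rightarrow> 'a set \<Rightarrow> 'a set" where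
  "cayley_sum_nbhd G S X = (set_inv\<^bsub>G\<^esub> X) <#>\<^bsub>G\<^esub> S"

definition vertex_boundary :: "('a, 'b) monoid_scheme \<Rightarrow> 'a set \<Rightarrow> 'a set \<Rightarrow> 'a set" where
  "vertex_boundary G S X = cayley_sum_nbhd G S X - X"

text \<open>For the trivial group the minimum ranges over the empty set and its value is unspecified.\<close>

definition vertex_cheeger :: "('a, 'b) monoid_scheme \<Rightarrow> 'a set \<Rightarrow> real" where
  "vertex_cheeger G S =
     Min {real (card (vertex_boundary G S X)) / real (card X) | X.
            X \<noteq> {} \<and> X \<subseteq> carrier G \<and> real (card X) \<le> real (card (carrier G)) / 2}"

definition is_expander :: "('a, 'b) monoid_scheme \<Rightarrow> 'a set \<Rightarrow> bool" where
  "is_expander G S \<longleftrightarrow> (\<exists>\<epsilon>>0. vertex_cheeger G S \<ge> \<epsilon>)"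

definition cayley_sum_bipartite :: "('a, 'b) monoid_scheme \<Rightarrow> 'a set \<Rightarrow> bool" where
  "cayley_sum_bipartite G S \<longleftrightarrow>
     (\<exists>U V. U \<union> V = carrier G \<and> U \<inter> V = {} \<and>
        (\<forall>g\<in>U. \<forall>h\<in>U. \<not> cayley_sum_adj G S g h) \<and>
        (\<forall>g\<in>V. \<forall>h\<in>V. \<not> cayley_sum_adj G S g h))"

text \<open>The list \<open>vs\<close> enumerates the vertices; it fixes the order of rows and columns.\<close>

definition adj_matrix :: "('a, 'b) monoid_scheme \<Rightarrow> 'a set \<Rightarrow> 'a list \<Rightarrow> real mat" where
  "adj_matrix G S vs = mat (length vs) (length vs)
     (\<lambda>(i, j). if cayley_sum_adj G S (vs ! i) (vs ! j) then 1 else 0)"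

definition norm_adj_matrix :: "('a, 'b) monoid_scheme \<Rightarrow> 'a set \<Rightarrow> 'a list \<Rightarrow> real mat" where
  "norm_adj_matrix G S vs = (1 / real (card S)) \<cdot>\<^sub>m adj_matrix G S vs"

definition norm_laplacian :: "('a, 'b) monoid_scheme \<Rightarrow> 'a set \<Rightarrow> 'a list \<Rightarrow> real mat" where
  "norm_laplacian G S vs = 1\<^sub>m (length vs) - norm_adj_matrix G S vs"

text \<open>Both matrices are real symmetric when \<open>S\<close> is closed under conjugation, so the real spectrum
  contains all eigenvalues.\<close>

definition largest_eigenvalue :: "real mat \<Rightarrow> real" where
  "largest_eigenvalue M = Max (spectrum M)"

definition smallest_eigenvalue :: "real mat \<Rightarrow> real" where
  "smallest_eigenvalue M = Min (spectrum M)"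

end

theory Submission
  imports Defs
begin

text \<open>Suppose some eigenvalue of the normalised adjacency matrix is within \<open>h\<^sup>4 / (2\<^sup>9 d\<^sup>8)\<close>
  of \<open>-1\<close>. Rounding its eigenvector at a level of its square yields disjoint sets \<open>L\<close>, \<open>R\<close> with few
  edges inside \<open>L\<close>, inside \<open>R\<close>, or leaving \<open>L \<union> R\<close>; by expansion \<open>L \<union> R\<close> is almost all of \<open>G\<close>, so
  \<open>X = L\<close> and its complement \<open>Y\<close> almost form a bipartition. For every \<open>g\<close> the set
  \<open>(X \<inter> g\<^sup>-\<^sup>1X) \<union> (Y \<inter> Yg)\<close> has few outgoing edges, so again by expansion it is almost empty or almost
  everything: \<open>gX\<close> is either almost disjoint from \<open>X\<close> or almost equal to it. The \<open>g\<close> of the second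
  kind form a subgroup \<open>H\<close> containing all products of two elements of \<open>S\<close>, and averaging
  \<open>|X - g\<^sup>-\<^sup>1X|\<close> over \<open>g\<close> shows that \<open>H\<close> has index exactly 2. As \<open>S\<close> generates \<open>G\<close>, it misses \<open>H\<close>,
  and \<open>H\<close> and its complement form an exact bipartition.\<close>

section \<open>Threshold rounding of eigenvectors on weighted graphs\<close>

text \<open>Layer-cake argument: the sum of \<open>w x * \<phi> x\<close> is the integral over
  \<open>\<tau>\<close> of the total weight of the level set at \<open>\<tau>\<close>, so some
  nonempty level set has nonpositive weight. The induction peels off one layer at a time.\<close>

lemma exists_level_set_weight_nonpos:
  fixes w \<phi> :: "'v \<Rightarrow> real"
  assumes "finite V" "\<And>x. x \<in> V \<Longrightarrow> \<phi> x \<ge> 0" "\<exists>x\<in>V. \<phi> x > 0"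
    and "(\<Sum>x\<in>V. w x * \<phi> x) \<le> 0"
  shows "\<exists>\<tau>>0. {x\<in>V. \<phi> x \<ge> \<tau>} \<noteq> {} \<and> (\<Sum>x\<in>{x\<in>V. \<phi> x \<ge> \<tau>}. w x) \<le> 0"
  using assms(2-)
proof (induction "card {x\<in>V. \<phi> x > 0}" arbitrary: \<phi> rule: less_induct)
  case less
  define P where "P = {x\<in>V. \<phi> x > 0}"
  have P: "finite P" "P \<noteq> {}" using less.prems assms(1) by (auto simp: P_def)
  define m where "m = Min (\<phi> ` P)"
  have m_in: "m \<in> \<phi> ` P" unfolding m_def using P by (intro Min_in) auto
  have m_le: "m \<le> \<phi> x" if "x \<in> P" for x unfolding m_def using P that by auto
  have m_pos: "m > 0" using m_in by (auto simp: P_def)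
  have P_eq: "P = {x\<in>V. \<phi> x \<ge> m}" using m_le m_pos by (force simp: P_def)
  show ?case
  proof (cases "(\<Sum>x\<in>P. w x) \<le> 0")
    case True
    then show ?thesis using m_pos P P_eq by auto
  next
    case False
    \<comment> \<open>Remove the lowest layer, of height \<open>m\<close>. The points with
      \<open>\<phi> x = m\<close> drop out of the support, and level \<open>\<tau>\<close> of
      \<open>\<psi>\<close> is level \<open>\<tau> + m\<close> of \<open>\<phi>\<close>.\<close>
    define \<psi> where "\<psi> x = (if x \<in> P then \<phi> x - m else 0)" for x
    have zero: "\<phi> x = 0" if "x \<in> V" "x \<notin> P" for x
      using that less.prems(1)[of x] by (auto simp: P_def)
    have "(\<Sum>x\<in>V. w x * \<phi> x) = (\<Sum>x\<in>V. (if x \<in> P then m * w x else 0) + w x * \<psi> x)"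
      by (intro sum.cong refl) (auto simp: \<psi>_def zero algebra_simps)
    also have "\<dots> = m * (\<Sum>x\<in>P. w x) + (\<Sum>x\<in>V. w x * \<psi> x)"
      using assms(1) by (simp add: sum.distrib sum.If_cases sum_distrib_left P_def Int_def)
    finally have *: "m * (\<Sum>x\<in>P. w x) + (\<Sum>x\<in>V. w x * \<psi> x) \<le> 0" using less.prems by simp
    have "m * (\<Sum>x\<in>P. w x) > 0" using False m_pos by simp
    with * have neg: "(\<Sum>x\<in>V. w x * \<psi> x) < 0" by linarith
    have \<psi>_nonneg: "\<psi> x \<ge> 0" for x using m_le by (auto simp: \<psi>_def)
    have pos: "\<exists>x\<in>V. \<psi> x > 0"
    proof (rule ccontr)
      assume "\<not> ?thesis"
      then have "\<psi> x = 0" if "x \<in> V" for x using \<psi>_nonneg[of x] that by force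
      with neg show False by simp
    qed
    have "{x\<in>V. \<psi> x > 0} \<subset> P"
    proof -
      have "{x\<in>V. \<psi> x > 0} \<subseteq> P" by (auto simp: \<psi>_def split: if_splits)
      moreover obtain x where "x \<in> P" "\<phi> x = m" using m_in by auto
      then have "x \<in> P" "\<not> \<psi> x > 0" by (auto simp: \<psi>_def)
      ultimately show ?thesis by blast
    qed
    then have "card {x\<in>V. \<psi> x > 0} < card {x\<in>V. \<phi> x > 0}"
      using P(1) by (metis P_def psubset_card_mono)
    from less.hyps[OF this \<psi>_nonneg pos] neg obtain \<tau> where \<tau>: "\<tau> > 0"
      "{x\<in>V. \<psi> x \<ge> \<tau>} \<noteq> {}" "(\<Sum>x\<in>{x\<in>V. \<psi> x \<ge> \<tau>}. w x) \<le> 0" by auto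
    have "{x\<in>V. \<psi> x \<ge> \<tau>} = {x\<in>V. \<phi> x \<ge> \<tau> + m}"
      using \<tau>(1) m_pos P_eq by (auto simp: \<psi>_def split: if_splits)
    then show ?thesis using \<tau> m_pos by (intro exI[of _ "\<tau> + m"]) auto
  qed
qed

text \<open>Lets an inequality that is symmetric in the two ends of an edge be summed, although each
  contribution is recorded at one end only.\<close>

lemma sum_symmetric_weights_double:
  fixes a k :: "'v \<Rightarrow> 'v \<Rightarrow> real"
  assumes sym: "\<And>x y. x \<in> V \<Longrightarrow> y \<in> V \<Longrightarrow> a x y = a y x"
  shows "(\<Sum>x\<in>V. \<Sum>y\<in>V. a x y * (k x y + k y x)) = 2 * (\<Sum>x\<in>V. \<Sum>y\<in>V. a x y * k x y)"
proof -
  have "(\<Sum>x\<in>V. \<Sum>y\<in>V. a x y * k y x) = (\<Sum>y\<in>V. \<Sum>x\<in>V. a x y * k y x)"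
    by (rule sum.swap)
  also have "\<dots> = (\<Sum>y\<in>V. \<Sum>x\<in>V. a y x * k y x)"
    by (intro sum.cong refl) (simp add: sym)
  finally show ?thesis by (simp add: distrib_left sum.distrib)
qed

text \<open>Trevisan's rounding: thresholding an eigenvector at a random level of its square
  produces a pair of sets that is almost a bipartition of its union.\<close>

lemma exists_almost_bipartition:
  fixes a :: "'v \<Rightarrow> 'v \<Rightarrow> real" and f :: "'v \<Rightarrow> real"
  assumes fin: "finite V"
    and sym: "\<And>x y. x \<in> V \<Longrightarrow> y \<in> V \<Longrightarrow> a x y = a y x"
    and nonneg: "\<And>x y. x \<in> V \<Longrightarrow> y \<in> V \<Longrightarrow> a x y \<ge> 0"
    and reg: "\<And>x. x \<in> V \<Longrightarrow> (\<Sum>y\<in>V. a x y) = D"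
    and ev: "\<And>x. x \<in> V \<Longrightarrow> (\<Sum>y\<in>V. a x y * f y) = D * t * f x"
    and nz: "\<exists>x\<in>V. f x \<noteq> 0"
    and \<beta>: "\<beta> > 0" "1 + t \<le> \<beta>\<^sup>2 / 2" and D: "D \<ge> 0"
  shows "\<exists>L R. L \<subseteq> V \<and> R \<subseteq> V \<and> L \<inter> R = {} \<and> L \<union> R \<noteq> {} \<and>
    (\<Sum>x\<in>L. \<Sum>y\<in>L. a x y) + (\<Sum>x\<in>R. \<Sum>y\<in>R. a x y)
      + (\<Sum>x\<in>L \<union> R. \<Sum>y\<in>V - (L \<union> R). a x y) \<le> \<beta> * D * real (card (L \<union> R))"
proof -
  define \<phi> where "\<phi> x = (f x)\<^sup>2" for x
  \<comment> \<open>An edge whose ends have the same sign is charged 1 at both ends; any other edge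
    is charged 1 at the end with the larger square and -1 at the other. Hence, when \<open>c\<close>
    is summed over a level set, the edges inside it that do not join equal signs cancel, while those
    joining equal signs and those leaving the set are counted.\<close>
  define \<sigma> where "\<sigma> x y = (if f x * f y > 0 then 1 else sgn (\<phi> x - \<phi> y))" for x y
  define c where "c x = (\<Sum>y\<in>V. a x y * \<sigma> x y)" for x
  define F where "F = (\<Sum>x\<in>V. \<phi> x)"

  \<comment> \<open>Summed over all edges, the first term is governed by \<open>1 + t\<close> and
    the second by the total of \<open>\<phi>\<close>. The hypothesis
    \<open>1 + t \<le> \<beta>\<^sup>2 / 2\<close> makes each of them contribute at most half of the
    final bound.\<close>
  have pointwise: "\<sigma> x y * \<phi> x + \<sigma> y x * \<phi> y
      \<le> (f x + f y)\<^sup>2 / \<beta> + \<beta> / 2 * (\<phi> x + \<phi> y)" for x y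
  proof -
    have "\<sigma> x y * \<phi> x + \<sigma> y x * \<phi> y \<le> \<bar>f x + f y\<bar> * (\<bar>f x\<bar> + \<bar>f y\<bar>)"
    proof (cases "f x * f y > 0")
      case True
      then have "\<bar>f x + f y\<bar> = \<bar>f x\<bar> + \<bar>f y\<bar>" by (auto simp: zero_less_mult_iff)
      then have "\<bar>f x + f y\<bar> * (\<bar>f x\<bar> + \<bar>f y\<bar>) = \<phi> x + \<phi> y + 2 * \<bar>f x * f y\<bar>"
        by (simp add: \<phi>_def power2_eq_square algebra_simps abs_mult abs_mult_self_eq)
      then show ?thesis using True by (simp add: \<sigma>_def mult.commute)
    next
      case False
      then have s: "\<sigma> x y = sgn (\<phi> x - \<phi> y)" "\<sigma> y x = - sgn (\<phi> x - \<phi> y)"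
        by (auto simp: \<sigma>_def mult.commute sgn_if)
      have "\<sigma> x y * \<phi> x + \<sigma> y x * \<phi> y = \<bar>\<phi> x - \<phi> y\<bar>"
        unfolding s by (auto simp: sgn_if)
      also have "\<dots> = \<bar>f x + f y\<bar> * \<bar>f x - f y\<bar>"
        by (simp add: \<phi>_def power2_eq_square abs_mult[symmetric] algebra_simps)
      also have "\<dots> \<le> \<bar>f x + f y\<bar> * (\<bar>f x\<bar> + \<bar>f y\<bar>)" by (intro mult_left_mono) auto
      finally show ?thesis .
    qed
    \<comment> \<open>AM-GM with weight \<open>\<beta>\<close>, obtained by completing the
      square.\<close>
    also have "\<dots> \<le> (f x + f y)\<^sup>2 / \<beta> + \<beta> / 4 * (\<bar>f x\<bar> + \<bar>f y\<bar>)\<^sup>2"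
    proof -
      have "0 \<le> (2 * \<bar>f x + f y\<bar> - \<beta> * (\<bar>f x\<bar> + \<bar>f y\<bar>))\<^sup>2 / (4 * \<beta>)" using \<beta> by simp
      also have "\<dots> = (f x + f y)\<^sup>2 / \<beta> + \<beta> / 4 * (\<bar>f x\<bar> + \<bar>f y\<bar>)\<^sup>2
          - \<bar>f x + f y\<bar> * (\<bar>f x\<bar> + \<bar>f y\<bar>)"
        using \<beta> by (simp add: power2_diff power_mult_distrib field_simps power2_eq_square)
      finally show ?thesis by simp
    qed
    also have "\<dots> \<le> (f x + f y)\<^sup>2 / \<beta> + \<beta> / 2 * (\<phi> x + \<phi> y)"
    proof -
      have "(\<bar>f x\<bar> + \<bar>f y\<bar>)\<^sup>2 \<le> 2 * (\<phi> x + \<phi> y)"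
        using sum_squares_bound[of "\<bar>f x\<bar>" "\<bar>f y\<bar>"] by (simp add: \<phi>_def power2_sum)
      then have "\<beta> / 4 * (\<bar>f x\<bar> + \<bar>f y\<bar>)\<^sup>2 \<le> \<beta> / 4 * (2 * (\<phi> x + \<phi> y))"
        using \<beta> by (intro mult_left_mono) auto
      then show ?thesis by (simp add: algebra_simps)
    qed
    finally show ?thesis .
  qed

  have degsum: "(\<Sum>x\<in>V. \<Sum>y\<in>V. a x y * \<phi> x) = D * F"
    by (simp add: sum_distrib_right[symmetric] reg F_def sum_distrib_left)
  \<comment> \<open>Here the eigenvalue equation enters: the total of
    \<open>(f x + f y)\<^sup>2\<close> over ordered pairs becomes
    \<open>2 * (1 + t) * D * F\<close>, which is small for \<open>t\<close> near -1.\<close>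
  have crosssum: "(\<Sum>x\<in>V. \<Sum>y\<in>V. a x y * (f x * f y)) = D * t * F"
  proof -
    have "(\<Sum>y\<in>V. a x y * (f x * f y)) = D * t * \<phi> x" if "x \<in> V" for x
    proof -
      have "(\<Sum>y\<in>V. a x y * (f x * f y)) = f x * (\<Sum>y\<in>V. a x y * f y)"
        by (simp add: sum_distrib_left mult_ac)
      then show ?thesis using ev[OF that] by (simp add: \<phi>_def power2_eq_square)
    qed
    then show ?thesis by (simp add: F_def sum_distrib_left)
  qed
  have "2 * (\<Sum>x\<in>V. \<phi> x * c x) = 2 * (\<Sum>x\<in>V. \<Sum>y\<in>V. a x y * (\<sigma> x y * \<phi> x))"
    by (simp add: c_def sum_distrib_left mult_ac)
  also have "\<dots> = (\<Sum>x\<in>V. \<Sum>y\<in>V. a x y * (\<sigma> x y * \<phi> x + \<sigma> y x * \<phi> y))"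
    by (rule sum_symmetric_weights_double[symmetric]) (rule sym)
  also have "\<dots> \<le> (\<Sum>x\<in>V. \<Sum>y\<in>V. a x y *
      ((\<phi> x / \<beta> + \<beta> / 2 * \<phi> x + f x * f y / \<beta>) + (\<phi> y / \<beta> + \<beta> / 2 * \<phi> y + f y * f x / \<beta>)))"
  proof (intro sum_mono mult_left_mono nonneg)
    fix x y
    have "(f x + f y)\<^sup>2 / \<beta> + \<beta> / 2 * (\<phi> x + \<phi> y) =
      (\<phi> x / \<beta> + \<beta> / 2 * \<phi> x + f x * f y / \<beta>) + (\<phi> y / \<beta> + \<beta> / 2 * \<phi> y + f y * f x / \<beta>)"
      by (simp add: \<phi>_def power2_sum add_divide_distrib algebra_simps)
    with pointwise[of x y] show "\<sigma> x y * \<phi> x + \<sigma> y x * \<phi> y \<le>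
      (\<phi> x / \<beta> + \<beta> / 2 * \<phi> x + f x * f y / \<beta>) + (\<phi> y / \<beta> + \<beta> / 2 * \<phi> y + f y * f x / \<beta>)"
      by simp
  qed
  also have "\<dots> = 2 * (\<Sum>x\<in>V. \<Sum>y\<in>V. a x y * (\<phi> x / \<beta> + \<beta> / 2 * \<phi> x + f x * f y / \<beta>))"
    by (rule sum_symmetric_weights_double) (rule sym)
  also have "(\<Sum>x\<in>V. \<Sum>y\<in>V. a x y * (\<phi> x / \<beta> + \<beta> / 2 * \<phi> x + f x * f y / \<beta>))
      = (1 / \<beta> + \<beta> / 2) * (\<Sum>x\<in>V. \<Sum>y\<in>V. a x y * \<phi> x)
        + 1 / \<beta> * (\<Sum>x\<in>V. \<Sum>y\<in>V. a x y * (f x * f y))"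
    unfolding sum_distrib_left sum.distrib[symmetric]
    by (intro sum.cong refl) (simp add: algebra_simps)
  also have "\<dots> = ((1 + t) / \<beta> + \<beta> / 2) * (D * F)"
    unfolding degsum crosssum using \<beta> by (simp add: field_simps)
  also have "\<dots> \<le> \<beta> * (D * F)"
  proof (rule mult_right_mono)
    show "(1 + t) / \<beta> + \<beta> / 2 \<le> \<beta>" using \<beta> by (simp add: field_simps power2_eq_square)
    show "0 \<le> D * F" using D by (simp add: F_def \<phi>_def sum_nonneg)
  qed
  finally have "(\<Sum>x\<in>V. \<phi> x * c x) \<le> \<beta> * D * F" by simp
  then have "(\<Sum>x\<in>V. (c x - \<beta> * D) * \<phi> x) \<le> 0"
    by (simp add: F_def algebra_simps sum_subtractf sum_distrib_left)
  moreover have "\<exists>x\<in>V. \<phi> x > 0" using nz by (auto simp: \<phi>_def)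
  ultimately obtain \<tau> where \<tau>: "\<tau> > 0" "{x\<in>V. \<phi> x \<ge> \<tau>} \<noteq> {}"
      "(\<Sum>x\<in>{x\<in>V. \<phi> x \<ge> \<tau>}. c x - \<beta> * D) \<le> 0"
    using exists_level_set_weight_nonpos[OF fin, of \<phi> "\<lambda>x. c x - \<beta> * D"] by (auto simp: \<phi>_def)
  define U where "U = {x\<in>V. \<phi> x \<ge> \<tau>}"
  define L where "L = {x\<in>U. f x > 0}"
  define R where "R = {x\<in>U. f x < 0}"
  have U_nz: "f x \<noteq> 0" if "x \<in> U" for x using that \<tau>(1) by (auto simp: U_def \<phi>_def)
  have LR: "L \<union> R = U" "L \<inter> R = {}" "U \<subseteq> V" "L \<subseteq> U" "R \<subseteq> U" "finite U"
    using fin U_nz by (auto simp: L_def R_def U_def not_less order_le_less)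
  have same: "(if f x * f y > 0 then 1 else 0::real)
      = (if x \<in> L \<and> y \<in> L then 1 else 0) + (if x \<in> R \<and> y \<in> R then 1 else 0)"
    if "x \<in> U" "y \<in> U" for x y
    using that by (auto simp: L_def R_def zero_less_mult_iff)
  \<comment> \<open>Outside the level set \<open>\<phi>\<close> is strictly smaller, so every edge
    leaving it is charged 1 at its inner end, whatever the signs.\<close>
  have cU: "c x = (\<Sum>y\<in>U. a x y * \<sigma> x y) + (\<Sum>y\<in>V - U. a x y)" if "x \<in> U" for x
  proof -
    have "c x = (\<Sum>y\<in>U. a x y * \<sigma> x y) + (\<Sum>y\<in>V - U. a x y * \<sigma> x y)"
      unfolding c_def using fin LR(3) by (simp add: sum.subset_diff add.commute)
    moreover have "\<sigma> x y = 1" if "y \<in> V - U" for y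
      using that \<open>x \<in> U\<close> by (auto simp: \<sigma>_def U_def)
    ultimately show ?thesis by simp
  qed
  have restrict: "(\<Sum>x\<in>U. \<Sum>y\<in>U. a x y * (if x \<in> Z \<and> y \<in> Z then 1 else 0))
      = (\<Sum>x\<in>Z. \<Sum>y\<in>Z. a x y)" if "Z \<subseteq> U" for Z
  proof -
    have "(\<Sum>x\<in>Z. \<Sum>y\<in>Z. a x y) = (\<Sum>x\<in>Z. \<Sum>y\<in>U. a x y * (if x \<in> Z \<and> y \<in> Z then 1 else 0))"
      using that LR(6) by (intro sum.cong refl sum.mono_neutral_cong_left) auto
    also have "\<dots> = (\<Sum>x\<in>U. \<Sum>y\<in>U. a x y * (if x \<in> Z \<and> y \<in> Z then 1 else 0))"
      using that LR(6) by (intro sum.mono_neutral_left) auto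
    finally show ?thesis ..
  qed
  have "2 * (\<Sum>x\<in>U. \<Sum>y\<in>U. a x y * \<sigma> x y) = (\<Sum>x\<in>U. \<Sum>y\<in>U. a x y * (\<sigma> x y + \<sigma> y x))"
    using LR(3) by (intro sum_symmetric_weights_double[symmetric] sym) auto
  also have "\<dots> = (\<Sum>x\<in>U. \<Sum>y\<in>U. a x y * (2 * (if f x * f y > 0 then 1 else 0)))"
    by (intro sum.cong refl arg_cong2[of _ _ _ _ "(*)"]) (auto simp: \<sigma>_def mult.commute sgn_if)
  also have "\<dots> = 2 * (\<Sum>x\<in>U. \<Sum>y\<in>U. a x y * (if f x * f y > 0 then 1 else 0))"
    by (simp add: sum_distrib_left mult_ac)
  also have "(\<Sum>x\<in>U. \<Sum>y\<in>U. a x y * (if f x * f y > 0 then 1 else 0))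
      = (\<Sum>x\<in>U. \<Sum>y\<in>U. a x y * (if x \<in> L \<and> y \<in> L then 1 else 0))
        + (\<Sum>x\<in>U. \<Sum>y\<in>U. a x y * (if x \<in> R \<and> y \<in> R then 1 else 0))"
    unfolding sum.distrib[symmetric] distrib_left[symmetric]
    by (intro sum.cong refl) (simp only: same)
  also note restrict[OF LR(4)]
  also note restrict[OF LR(5)]
  finally have inner: "(\<Sum>x\<in>U. \<Sum>y\<in>U. a x y * \<sigma> x y)
      = (\<Sum>x\<in>L. \<Sum>y\<in>L. a x y) + (\<Sum>x\<in>R. \<Sum>y\<in>R. a x y)" by simp
  have "(\<Sum>x\<in>U. c x) = (\<Sum>x\<in>U. \<Sum>y\<in>U. a x y * \<sigma> x y) + (\<Sum>x\<in>U. \<Sum>y\<in>V - U. a x y)"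
    by (simp add: cU sum.distrib)
  moreover have "(\<Sum>x\<in>U. c x) \<le> \<beta> * D * real (card U)"
    using \<tau>(3) by (simp add: U_def[symmetric] sum_subtractf mult_ac)
  ultimately have "(\<Sum>x\<in>L. \<Sum>y\<in>L. a x y) + (\<Sum>x\<in>R. \<Sum>y\<in>R. a x y)
      + (\<Sum>x\<in>L \<union> R. \<Sum>y\<in>V - (L \<union> R). a x y) \<le> \<beta> * D * real (card (L \<union> R))"
    unfolding LR(1) inner by linarith
  moreover have "L \<subseteq> V" "R \<subseteq> V" "L \<union> R \<noteq> {}" using LR \<tau>(2) U_def by auto
  ultimately show ?thesis using LR(2) by blast
qed

section \<open>Edge counts and expansion in a Cayley sum graph\<close>

locale cayley_sum_graph = group G for G (structure) +
  fixes S :: "'a set"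
  assumes fin: "finite (carrier G)"
    and S_carrier: "S \<subseteq> carrier G"
    and S_inv: "s \<in> S \<Longrightarrow> inv s \<in> S"
    and S_conj: "g \<in> carrier G \<Longrightarrow> s \<in> S \<Longrightarrow> g \<otimes> s \<otimes> inv g \<in> S"
begin

text \<open>Ordered pairs, to agree with double sums of adjacency entries: in
  \<open>edges A A\<close> an edge between distinct vertices counts twice and a loop once.\<close>

definition edges :: "'a set \<Rightarrow> 'a set \<Rightarrow> ('a \<times> 'a) set" where
  "edges A B = {(x, y). x \<in> A \<and> y \<in> B \<and> x \<otimes> y \<in> S}"

lemma edges_mono: "A \<subseteq> A' \<Longrightarrow> B \<subseteq> B' \<Longrightarrow> edges A B \<subseteq> edges A' B'"
  by (auto simp: edges_def)

lemma finite_edges: "A \<subseteq> carrier G \<Longrightarrow> B \<subseteq> carrier G \<Longrightarrow> finite (edges A B)"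
  using fin by (intro finite_subset[of "edges A B" "carrier G \<times> carrier G"]) (auto simp: edges_def)

text \<open>The two products are conjugate by \<open>y\<close>; closure of \<open>S\<close> under
  conjugation is what makes the graph undirected.\<close>

lemma mult_mem_S_commute:
  assumes "x \<in> carrier G" "y \<in> carrier G" "x \<otimes> y \<in> S"
  shows "y \<otimes> x \<in> S"
proof -
  have "y \<otimes> (x \<otimes> y) \<otimes> inv y \<in> S" using assms S_conj by blast
  then show ?thesis using assms(1,2) by (simp add: m_assoc)
qed

lemma card_edges_commute:
  assumes "A \<subseteq> carrier G" "B \<subseteq> carrier G"
  shows "card (edges A B) = card (edges B A)"
proof (rule bij_betw_same_card[of "\<lambda>(x, y). (y, x)"])
  show "bij_betw (\<lambda>(x, y). (y, x)) (edges A B) (edges B A)"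
    using assms by (intro bij_betwI[where g = "\<lambda>(x, y). (y, x)"])
      (auto simp: edges_def intro: mult_mem_S_commute)
qed

lemma card_nbrs:
  assumes "x \<in> carrier G"
  shows "card {y \<in> carrier G. x \<otimes> y \<in> S} = card S"
proof (rule bij_betw_same_card[of "\<lambda>y. x \<otimes> y"])
  show "bij_betw (\<lambda>y. x \<otimes> y) {y \<in> carrier G. x \<otimes> y \<in> S} S"
    using assms S_carrier by (intro bij_betwI[where g = "\<lambda>s. inv x \<otimes> s"])
      (auto simp: m_assoc[symmetric])
qed

lemma card_edges_sum:
  assumes "A \<subseteq> carrier G" "B \<subseteq> carrier G"
  shows "card (edges A B) = (\<Sum>x\<in>A. card {y\<in>B. x \<otimes> y \<in> S})"
proof -
  have "edges A B = Sigma A (\<lambda>x. {y\<in>B. x \<otimes> y \<in> S})" by (auto simp: edges_def)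
  then show ?thesis using assms fin by (simp add: finite_subset)
qed

lemma card_edges_carrier:
  assumes "A \<subseteq> carrier G"
  shows "card (edges A (carrier G)) = card A * card S"
proof -
  have "card (edges A (carrier G)) = (\<Sum>x\<in>A. card S)"
    unfolding card_edges_sum[OF assms order_refl] using assms card_nbrs by (intro sum.cong) auto
  then show ?thesis by simp
qed

lemma card_edges_Un:
  assumes "A \<subseteq> carrier G" "B \<subseteq> carrier G" "C \<subseteq> carrier G" "B \<inter> C = {}"
  shows "card (edges A (B \<union> C)) = card (edges A B) + card (edges A C)"
proof -
  have "edges A (B \<union> C) = edges A B \<union> edges A C" "edges A B \<inter> edges A C = {}"
    using assms(4) by (auto simp: edges_def)
  then show ?thesis using finite_edges assms by (simp add: card_Un_disjoint)
qed

lemma card_edges_Un_left: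
  assumes "A \<subseteq> carrier G" "B \<subseteq> carrier G" "C \<subseteq> carrier G" "B \<inter> C = {}"
  shows "card (edges (B \<union> C) A) = card (edges B A) + card (edges C A)"
  using card_edges_Un[OF assms] card_edges_commute[OF assms(1,2)] card_edges_commute[OF assms(1,3)]
    card_edges_commute[of A "B \<union> C"] assms(1-3) by simp

text \<open>Every boundary vertex is the far end of at least one edge leaving
  \<open>A\<close>.\<close>

lemma card_boundary_le_edges:
  assumes "A \<subseteq> carrier G"
  shows "card (vertex_boundary G S A) \<le> card (edges A (carrier G - A))"
proof -
  have "vertex_boundary G S A \<subseteq> snd ` edges A (carrier G - A)"
  proof
    fix y assume "y \<in> vertex_boundary G S A"
    then obtain x s where *: "x \<in> A" "s \<in> S" "y = inv x \<otimes> s" "y \<notin> A"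
      by (auto simp: vertex_boundary_def cayley_sum_nbhd_def set_mult_def SET_INV_def)
    have "x \<in> carrier G" "s \<in> carrier G" using * assms S_carrier by auto
    then have "x \<otimes> y = s" "y \<in> carrier G" using * by (auto simp: m_assoc[symmetric])
    then have "(x, y) \<in> edges A (carrier G - A)" using * by (simp add: edges_def)
    then show "y \<in> snd ` edges A (carrier G - A)" by force
  qed
  then show ?thesis
    using finite_edges[OF assms, of "carrier G - A"]
    by (meson Diff_subset card_image_le card_mono finite_imageI order_trans)
qed

lemma finite_cheeger_quotients:
  "finite {real (card (vertex_boundary G S X)) / real (card X) | X.
     X \<noteq> {} \<and> X \<subseteq> carrier G \<and> real (card X) \<le> real (card (carrier G)) / 2}"
proof (rule finite_subset)
  show "{real (card (vertex_boundary G S X)) / real (card X) | X.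
     X \<noteq> {} \<and> X \<subseteq> carrier G \<and> real (card X) \<le> real (card (carrier G)) / 2}
     \<subseteq> (\<lambda>X. real (card (vertex_boundary G S X)) / real (card X)) ` Pow (carrier G)" by auto
qed (use fin in simp)

lemma cheeger_le_edges:
  assumes "A \<subseteq> carrier G" "2 * card A \<le> card (carrier G)"
  shows "vertex_cheeger G S * card A \<le> card (edges A (carrier G - A))"
proof (cases "A = {}")
  case False
  have "finite A" using assms fin finite_subset by blast
  then have "card A > 0" using False by (simp add: card_gt_0_iff)
  have "real (2 * card A) \<le> real (card (carrier G))" using assms(2) of_nat_le_iff by blast
  then have "real (card (vertex_boundary G S A)) / real (card A) \<in>
    {real (card (vertex_boundary G S X)) / real (card X) | X.
      X \<noteq> {} \<and> X \<subseteq> carrier G \<and> real (card X) \<le> real (card (carrier G)) / 2}"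
    using False assms(1) by auto
  then have "vertex_cheeger G S \<le> real (card (vertex_boundary G S A)) / real (card A)"
    unfolding vertex_cheeger_def by (rule Min_le[OF finite_cheeger_quotients])
  then have "vertex_cheeger G S * card A \<le> card (vertex_boundary G S A)"
    using \<open>card A > 0\<close> by (simp add: field_simps)
  also have "\<dots> \<le> card (edges A (carrier G - A))"
    using card_boundary_le_edges[OF assms(1)] by simp
  finally show ?thesis .
qed simp

text \<open>If \<open>A\<close> exceeds half of the group, expansion is applied to its complement,
  which has equally many crossing edges. The minimum avoids having to know in advance which side is
  small.\<close>

lemma cheeger_min_le_edges:
  assumes "A \<subseteq> carrier G" "vertex_cheeger G S \<ge> 0"
  shows "vertex_cheeger G S * min (card A) (card (carrier G - A)) \<le> card (edges A (carrier G - A))"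
proof (cases "2 * card A \<le> card (carrier G)")
  case True
  have "vertex_cheeger G S * min (card A) (card (carrier G - A)) \<le> vertex_cheeger G S * card A"
    using assms(2) by (intro mult_left_mono) auto
  then show ?thesis using cheeger_le_edges[OF assms(1) True] by linarith
next
  case False
  have "card (carrier G - A) = card (carrier G) - card A"
    using assms(1) fin by (simp add: card_Diff_subset finite_subset)
  then have small: "2 * card (carrier G - A) \<le> card (carrier G)" using False by linarith
  have "carrier G - (carrier G - A) = A" using assms(1) by auto
  then have "vertex_cheeger G S * card (carrier G - A) \<le> card (edges A (carrier G - A))"
    using cheeger_le_edges[OF _ small] card_edges_commute[OF assms(1), of "carrier G - A"] by simp
  moreover have "vertex_cheeger G S * min (card A) (card (carrier G - A))
      \<le> vertex_cheeger G S * card (carrier G - A)"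
    using assms(2) by (intro mult_left_mono) auto
  ultimately show ?thesis by linarith
qed

text \<open>Test the singleton of the identity, which is at most half of the group once there are
  two vertices.\<close>

lemma cheeger_le_degree:
  assumes "card (carrier G) \<ge> 2"
  shows "vertex_cheeger G S \<le> card S"
proof -
  have "vertex_cheeger G S * card {\<one>} \<le> card (edges {\<one>} (carrier G - {\<one>}))"
    using assms by (intro cheeger_le_edges) auto
  also have "\<dots> \<le> card (edges {\<one>} (carrier G))"
    unfolding of_nat_le_iff by (intro card_mono finite_edges edges_mono) auto
  also have "\<dots> = card S" by (simp add: card_edges_carrier)
  finally show ?thesis by simp
qed

section \<open>Displacement of a set under left translation\<close>

text \<open>For \<open>X\<close> inside the group this is half the size of the symmetric difference
  of \<open>X\<close> and \<open>g^-1 X\<close>. It behaves like a length function on the group, so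
  elements of small displacement are candidates for a subgroup.\<close>

definition displacement :: "'a set \<Rightarrow> 'a \<Rightarrow> nat" where
  "displacement X g = card {x\<in>X. g \<otimes> x \<notin> X}"

text \<open>The edges leaving \<open>B\<close> are mapped to edges inside \<open>X\<close> or inside \<open>Y\<close> by
  \<open>(b, c) \<mapsto> (g b, c g\<^sup>-\<^sup>1)\<close> and \<open>(b, c) \<mapsto> (b g\<^sup>-\<^sup>1, g c)\<close>, which preserve adjacency.\<close>

lemma card_edges_translate_overlap:
  assumes X: "X \<subseteq> carrier G" and g: "g \<in> carrier G"
    and Y: "Y = carrier G - X"
    and B: "B = {x\<in>X. g \<otimes> x \<in> X} \<union> {y\<in>Y. y \<otimes> inv g \<in> Y}"
  shows "card (edges B (carrier G - B)) \<le> 2 * (card (edges X X) + card (edges Y Y))"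
proof -
  define p where "p = (\<lambda>(b, c). (g \<otimes> b, c \<otimes> inv g))"
  define q where "q = (\<lambda>(b, c). (b \<otimes> inv g, g \<otimes> c))"
  define E1 where "E1 = {e \<in> edges (carrier G) (carrier G). p e \<in> edges X X}"
  define E2 where "E2 = {e \<in> edges (carrier G) (carrier G). q e \<in> edges Y Y}"
  have Yc: "Y \<subseteq> carrier G" using Y by auto
  have finE: "finite E1" "finite E2"
    using finite_edges[of "carrier G" "carrier G"] by (auto simp: E1_def E2_def)
  have "inj_on p E1" using g by (auto simp: inj_on_def p_def E1_def edges_def)
  then have c1: "card E1 \<le> card (edges X X)"
    by (rule card_inj_on_le) (auto simp: E1_def finite_edges X)
  have "inj_on q E2" using g by (auto simp: inj_on_def q_def E2_def edges_def)
  then have c2: "card E2 \<le> card (edges Y Y)"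
    by (rule card_inj_on_le) (auto simp: E2_def finite_edges Yc)
  \<comment> \<open>If \<open>b\<close> and \<open>c\<close> lie on the same side, the edge itself
    is inside \<open>X\<close> or \<open>Y\<close>. Otherwise \<open>c \<notin> B\<close> forces
    \<open>c\<close> to change sides under the relevant translation: \<open>p\<close> then gives an
    edge inside \<open>X\<close> when \<open>b \<in> X\<close>, and \<open>q\<close> one inside
    \<open>Y\<close> when \<open>b \<in> Y\<close>.\<close>
  have "edges B (carrier G - B) \<subseteq> (edges X X \<union> edges Y Y) \<union> (E1 \<union> E2)"
  proof
    fix e assume "e \<in> edges B (carrier G - B)"
    then obtain b c where e: "e = (b, c)" "b \<in> B" "c \<in> carrier G" "c \<notin> B" "b \<otimes> c \<in> S"
      by (auto simp: edges_def)
    have bc: "b \<in> carrier G" using e B X Y by auto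
    have "g \<otimes> b \<otimes> (c \<otimes> inv g) = g \<otimes> (b \<otimes> c) \<otimes> inv g" using bc e g by (simp add: m_assoc)
    then have S1: "g \<otimes> b \<otimes> (c \<otimes> inv g) \<in> S" using S_conj g e by simp
    have "b \<otimes> inv g \<otimes> (g \<otimes> c) = b \<otimes> (inv g \<otimes> g \<otimes> c)" using bc e g by (simp only: m_assoc m_closed inv_closed)
    then have S2: "b \<otimes> inv g \<otimes> (g \<otimes> c) \<in> S" using bc e g by simp
    have cl: "c \<otimes> inv g \<in> carrier G" "g \<otimes> c \<in> carrier G" using e g by auto
    show "e \<in> (edges X X \<union> edges Y Y) \<union> (E1 \<union> E2)"
      using e bc S1 S2 cl
      by (auto simp: B Y edges_def E1_def E2_def p_def q_def)
  qed
  then have "card (edges B (carrier G - B)) \<le> card ((edges X X \<union> edges Y Y) \<union> (E1 \<union> E2))"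
    using finE finite_edges X Yc by (intro card_mono) auto
  also have "\<dots> \<le> (card (edges X X) + card (edges Y Y)) + (card E1 + card E2)"
    by (meson add_mono card_Un_le order_trans)
  finally show ?thesis using c1 c2 by simp
qed

lemma displacement_le: "X \<subseteq> carrier G \<Longrightarrow> displacement X g \<le> card X"
  unfolding displacement_def by (intro card_mono) (auto intro: finite_subset[OF _ fin])

text \<open>The overlap set \<open>B\<close> has at most \<open>2 * \<delta>\<close> outgoing edges,
  so by expansion \<open>B\<close> or its complement is small. The points of \<open>X\<close> kept
  in \<open>X\<close> by \<open>g\<close> lie in \<open>B\<close>, the ones moved out lie in the
  complement.\<close>

lemma displacement_dichotomy:
  assumes X: "X \<subseteq> carrier G" and g: "g \<in> carrier G"
    and h: "vertex_cheeger G S > 0"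
    and \<delta>: "real (card (edges X X)) + card (edges (carrier G - X) (carrier G - X)) \<le> \<delta>"
  shows "displacement X g \<le> 2 * \<delta> / vertex_cheeger G S
    \<or> real (card X) - real (displacement X g) \<le> 2 * \<delta> / vertex_cheeger G S"
proof -
  define Y where "Y = carrier G - X"
  define B where "B = {x\<in>X. g \<otimes> x \<in> X} \<union> {y\<in>Y. y \<otimes> inv g \<in> Y}"
  have Bc: "B \<subseteq> carrier G" using X by (auto simp: B_def Y_def)
  have finX: "finite X" using X fin finite_subset by blast
  have "real (card (edges B (carrier G - B))) \<le> real (2 * (card (edges X X) + card (edges Y Y)))"
    using card_edges_translate_overlap[OF X g Y_def B_def] of_nat_le_iff by blast
  then have "vertex_cheeger G S * min (card B) (card (carrier G - B)) \<le> 2 * \<delta>"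
    using cheeger_min_le_edges[OF Bc] h \<delta> by (simp add: Y_def)
  then have m: "min (card B) (card (carrier G - B)) \<le> 2 * \<delta> / vertex_cheeger G S"
    using h by (simp add: field_simps)
  have "{x\<in>X. g \<otimes> x \<notin> X} \<subseteq> carrier G - B" using X by (auto simp: B_def Y_def)
  then have 1: "displacement X g \<le> card (carrier G - B)"
    unfolding displacement_def using fin by (intro card_mono) auto
  have "{x\<in>X. g \<otimes> x \<in> X} = X - {x\<in>X. g \<otimes> x \<notin> X}" by auto
  then have "card {x\<in>X. g \<otimes> x \<in> X} = card X - displacement X g"
    unfolding displacement_def using finX by (simp add: card_Diff_subset)
  moreover have "card {x\<in>X. g \<otimes> x \<in> X} \<le> card B"
    using Bc fin by (intro card_mono) (auto simp: B_def intro: finite_subset)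
  ultimately have 2: "card X - displacement X g \<le> card B" by simp
  show ?thesis using 1 2 m displacement_le[OF X, of g] by (auto simp: min_def split: if_splits)
qed

text \<open>Triangle inequality: a point moved out by the product is either moved out by
  \<open>h\<close>, or sent by \<open>h\<close> to a point of \<open>X\<close> that \<open>g\<close>
  moves out.\<close>

lemma displacement_mult:
  assumes X: "X \<subseteq> carrier G" and g: "g \<in> carrier G" "h \<in> carrier G"
  shows "displacement X (g \<otimes> h) \<le> displacement X g + displacement X h"
proof -
  have finX: "finite X" using X fin finite_subset by blast
  let ?A = "{x\<in>X. h \<otimes> x \<in> X \<and> g \<otimes> (h \<otimes> x) \<notin> X}"
  have "{x\<in>X. g \<otimes> h \<otimes> x \<notin> X} \<subseteq> {x\<in>X. h \<otimes> x \<notin> X} \<union> ?A"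
    using X g by (auto simp: m_assoc subset_iff)
  then have "displacement X (g \<otimes> h) \<le> card ({x\<in>X. h \<otimes> x \<notin> X} \<union> ?A)"
    unfolding displacement_def using finX by (intro card_mono) auto
  also have "\<dots> \<le> displacement X h + card ?A"
    unfolding displacement_def by (rule card_Un_le)
  also have "card ?A \<le> displacement X g" unfolding displacement_def
    using finX X g by (intro card_inj_on_le[of "\<lambda>x. h \<otimes> x"]) (auto simp: inj_on_def subset_iff)
  finally show ?thesis by simp
qed

text \<open>Translation by \<open>g\<close> matches the points of \<open>X\<close> that
  \<open>g\<close> keeps in \<open>X\<close> with those that its inverse keeps.\<close>

lemma displacement_inv:
  assumes X: "X \<subseteq> carrier G" and g: "g \<in> carrier G"
  shows "displacement X (inv g) = displacement X g"
proof -
  have finX: "finite X" using X fin finite_subset by blast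
  have eq: "displacement X k = card X - card {x\<in>X. k \<otimes> x \<in> X}" for k
  proof -
    have "{x\<in>X. k \<otimes> x \<notin> X} = X - {x\<in>X. k \<otimes> x \<in> X}" by auto
    then show ?thesis unfolding displacement_def using finX by (simp add: card_Diff_subset)
  qed
  have "bij_betw (\<lambda>x. g \<otimes> x) {x\<in>X. g \<otimes> x \<in> X} {x\<in>X. inv g \<otimes> x \<in> X}"
    using X g by (intro bij_betwI[where g = "\<lambda>x. inv g \<otimes> x"])
      (auto simp: m_assoc[symmetric] subset_iff)
  then show ?thesis unfolding eq using bij_betw_same_card by fastforce
qed

lemma displacement_one: "X \<subseteq> carrier G \<Longrightarrow> displacement X \<one> = 0"
  by (force simp: displacement_def card_eq_0_iff)

text \<open>With \<open>z = x\<^sup>-\<^sup>1 t\<^sup>-\<^sup>1\<close>, both \<open>x z = t\<^sup>-\<^sup>1\<close> and \<open>(s t x) z = s\<close> lie in \<open>S\<close>, so \<open>z\<close> forms an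
  edge inside \<open>X\<close> with \<open>x\<close> or one inside the complement with \<open>s t x\<close>.\<close>

lemma displacement_mult_S:
  assumes X: "X \<subseteq> carrier G" and st: "s \<in> S" "t \<in> S"
  shows "displacement X (s \<otimes> t) \<le> card (edges X X) + card (edges (carrier G - X) (carrier G - X))"
proof -
  define Y where "Y = carrier G - X"
  have finX: "finite X" using X fin finite_subset by blast
  have c: "s \<in> carrier G" "t \<in> carrier G" using st S_carrier by auto
  define z where "z x = inv x \<otimes> inv t" for x
  let ?A = "{x\<in>X. z x \<in> X}" and ?C = "{x\<in>X. z x \<notin> X \<and> s \<otimes> t \<otimes> x \<notin> X}"
  have xz: "x \<otimes> z x = inv t" "s \<otimes> t \<otimes> x \<otimes> z x = s" "z x \<in> carrier G" if "x \<in> X" for x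
  proof -
    have x: "x \<in> carrier G" using that X by auto
    show 1: "x \<otimes> z x = inv t" using x c by (simp add: z_def m_assoc[symmetric])
    show 2: "z x \<in> carrier G" using x c by (simp add: z_def)
    show "s \<otimes> t \<otimes> x \<otimes> z x = s" using x c 2 by (simp add: m_assoc 1)
  qed
  have "card ?A \<le> card (edges X X)"
  proof (rule card_inj_on_le[of "\<lambda>x. (x, z x)"])
    show "(\<lambda>x. (x, z x)) ` ?A \<subseteq> edges X X" using X S_inv st xz by (auto simp: edges_def)
  qed (auto simp: inj_on_def finite_edges X)
  moreover have "card ?C \<le> card (edges Y Y)"
  proof (rule card_inj_on_le[of "\<lambda>x. (s \<otimes> t \<otimes> x, z x)"])
    show "inj_on (\<lambda>x. (s \<otimes> t \<otimes> x, z x)) ?C" using X c by (auto simp: inj_on_def subset_iff)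
    show "(\<lambda>x. (s \<otimes> t \<otimes> x, z x)) ` ?C \<subseteq> edges Y Y"
      using X c st xz by (auto simp: edges_def Y_def)
    show "finite (edges Y Y)" by (auto simp: finite_edges Y_def)
  qed
  moreover have "displacement X (s \<otimes> t) \<le> card (?A \<union> ?C)"
    unfolding displacement_def using finX by (intro card_mono) auto
  moreover have "card (?A \<union> ?C) \<le> card ?A + card ?C" by (rule card_Un_le)
  ultimately show ?thesis unfolding Y_def by linarith
qed

text \<open>Double counting: for each \<open>x\<close> in \<open>X\<close> and \<open>y\<close>
  outside, exactly one \<open>g\<close> carries \<open>x\<close> to \<open>y\<close>.\<close>

lemma sum_displacement:
  assumes X: "X \<subseteq> carrier G"
  shows "(\<Sum>g\<in>carrier G. displacement X g) = card X * card (carrier G - X)"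
proof -
  have finX: "finite X" using X fin finite_subset by blast
  have "(\<Sum>g\<in>carrier G. displacement X g)
      = card (Sigma (carrier G) (\<lambda>g. {x\<in>X. g \<otimes> x \<notin> X}))"
    unfolding displacement_def using fin finX by simp
  also have "\<dots> = card (X \<times> (carrier G - X))"
  proof (rule bij_betw_same_card[of "\<lambda>(g, x). (x, g \<otimes> x)"])
    show "bij_betw (\<lambda>(g, x). (x, g \<otimes> x)) (Sigma (carrier G) (\<lambda>g. {x\<in>X. g \<otimes> x \<notin> X}))
        (X \<times> (carrier G - X))"
      using X by (intro bij_betwI[where g = "\<lambda>(x, y). (y \<otimes> inv x, x)"])
        (auto simp: m_assoc subset_iff)
  qed
  finally show ?thesis by (simp add: card_cartesian_product)
qed

section \<open>Exact bipartitions from subgroups, and small degrees\<close>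

lemma cayley_sum_bipartiteI:
  assumes "U \<union> V = carrier G" "U \<inter> V = {}"
    and "\<And>x y. x \<in> U \<Longrightarrow> y \<in> U \<Longrightarrow> x \<otimes> y \<notin> S" "\<And>x y. x \<in> V \<Longrightarrow> y \<in> V \<Longrightarrow> x \<otimes> y \<notin> S"
  shows "cayley_sum_bipartite G S"
  unfolding cayley_sum_bipartite_def cayley_sum_adj_def
  by (rule exI[of _ U], rule exI[of _ V]) (simp add: assms)

text \<open>The size conditions force index 2, so products within \<open>H\<close> and within its
  complement both land in \<open>H\<close>. It remains that \<open>S\<close> misses
  \<open>H\<close>: one common element \<open>s\<close> would put every
  \<open>t = s^-1 (s t)\<close> of \<open>S\<close> into \<open>H\<close>, against
  generation.\<close>

lemma bipartite_of_subgroup: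
  assumes H: "subgroup H G" "card (carrier G) < 3 * card H" "H \<noteq> carrier G"
    and gen: "generate G S = carrier G"
    and SS: "\<And>s t. s \<in> S \<Longrightarrow> t \<in> S \<Longrightarrow> s \<otimes> t \<in> H"
  shows "cayley_sum_bipartite G S"
proof -
  have Hc: "H \<subseteq> carrier G" using H(1) by (rule subgroup.subset)
  have "S \<inter> H = {}"
  proof (rule ccontr)
    assume "S \<inter> H \<noteq> {}"
    then obtain s where s: "s \<in> S" "s \<in> H" by auto
    have "S \<subseteq> H"
    proof
      fix t assume t: "t \<in> S"
      have "inv s \<otimes> (s \<otimes> t) \<in> H"
        using SS[OF s(1) t] s H(1) by (simp add: subgroup.m_closed subgroup.m_inv_closed)
      then show "t \<in> H" using s t S_carrier by (simp add: m_assoc[symmetric] subset_iff)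
    qed
    then have "generate G S \<subseteq> H" using generate_subgroup_incl H(1) by blast
    then show False using gen H(3) Hc by blast
  qed
  \<comment> \<open>Otherwise \<open>H\<close>, \<open>y H\<close> and \<open>x^-1 H\<close> are
    three disjoint cosets, too many for the size of the group.\<close>
  moreover have "x \<otimes> y \<in> H" if xy: "x \<in> carrier G - H" "y \<in> carrier G - H" for x y
  proof (rule ccontr)
    assume n: "x \<otimes> y \<notin> H"
    have xc: "x \<in> carrier G" "inv x \<in> carrier G" "y \<in> carrier G" using xy by auto
    have img: "card ((\<lambda>k. a \<otimes> k) ` H) = card H" if "a \<in> carrier G" for a
      using that Hc by (intro card_image) (auto simp: inj_on_def subset_iff)
    have mem: "a \<in> H" if "a \<in> carrier G" "k \<in> H" "l \<in> H" "a \<otimes> k = l" for a k l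
    proof -
      have "a = l \<otimes> inv k" using that Hc by (metis inv_solve_right subsetD)
      then show ?thesis using that H(1) by (simp add: subgroup.m_closed subgroup.m_inv_closed)
    qed
    have d1: "(\<lambda>k. y \<otimes> k) ` H \<inter> H = {}" using mem xc xy by blast
    have d2: "(\<lambda>k. inv x \<otimes> k) ` H \<inter> H = {}"
    proof -
      have "inv x \<notin> H" using xy H(1) xc by (metis DiffD2 inv_inv subgroup.m_inv_closed)
      then show ?thesis using mem xc by blast
    qed
    have d3: "(\<lambda>k. y \<otimes> k) ` H \<inter> (\<lambda>k. inv x \<otimes> k) ` H = {}"
    proof (rule ccontr)
      assume "\<not> ?thesis"
      then obtain k l where kl: "k \<in> H" "l \<in> H" "y \<otimes> k = inv x \<otimes> l" by auto
      have "x \<otimes> y \<otimes> k = x \<otimes> (inv x \<otimes> l)" using kl xc Hc by (simp add: m_assoc subset_iff)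
      also have "\<dots> = l" using kl xc Hc by (simp add: m_assoc[symmetric] subset_iff)
      finally have "x \<otimes> y \<in> H" using mem[of "x \<otimes> y"] kl xc by simp
      with n show False by simp
    qed
    have finH: "finite H" using Hc fin finite_subset by blast
    have "card (H \<union> (\<lambda>k. y \<otimes> k) ` H \<union> (\<lambda>k. inv x \<otimes> k) ` H) = 3 * card H"
      using d1 d2 d3 finH img xc by (subst card_Un_disjoint; (subst card_Un_disjoint)?) auto
    moreover have "H \<union> (\<lambda>k. y \<otimes> k) ` H \<union> (\<lambda>k. inv x \<otimes> k) ` H \<subseteq> carrier G"
      using xc Hc by auto
    ultimately have "3 * card H \<le> card (carrier G)" using fin by (metis card_mono)
    with H(2) show False by simp
  qed
  moreover have "x \<otimes> y \<in> H" if "x \<in> H" "y \<in> H" for x y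
    using that H(1) by (rule subgroup.m_closed[rotated])
  ultimately show ?thesis
    using Hc by (intro cayley_sum_bipartiteI[of H "carrier G - H"]) blast+
qed

text \<open>Degree 0 leaves no edges. If \<open>S = {s}\<close>, then \<open>s\<close> is an
  involution and the group is \<open>{\<one>, s}\<close>, whose two singletons carry no loop since
  both squares are \<open>\<one>\<close>.\<close>

lemma card_S_ge_2:
  assumes gen: "generate G S = carrier G" and one: "\<one> \<notin> S"
    and nb: "\<not> cayley_sum_bipartite G S"
  shows "card S \<ge> 2"
proof (rule ccontr)
  assume "\<not> ?thesis"
  moreover have "finite S" using S_carrier fin finite_subset by blast
  ultimately consider "S = {}" | s where "S = {s}"
    by (metis One_nat_def card_0_eq card_1_singletonE less_2_cases not_less)
  then show False
  proof cases
    case 1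
    then have "cayley_sum_bipartite G S"
      by (intro cayley_sum_bipartiteI[of "carrier G" "{}"]) auto
    with nb show False by simp
  next
    case (2 s)
    have s: "s \<in> carrier G" "inv s = s" "s \<noteq> \<one>" using 2 S_carrier S_inv one by auto
    then have ss: "s \<otimes> s = \<one>" by (metis l_inv)
    have "subgroup {\<one>, s} G" using s ss by unfold_locales auto
    then have "generate G S \<subseteq> {\<one>, s}" using generate_subgroup_incl[of S "{\<one>, s}"] 2 by auto
    then have "carrier G = {\<one>} \<union> {s}" using gen s by auto
    then have "cayley_sum_bipartite G S"
      using s ss 2 by (intro cayley_sum_bipartiteI[of "{\<one>}" "{s}"]) auto
    with nb show False by simp
  qed
qed

section \<open>From an almost bipartition to an exact one\<close>

text \<open>Expansion makes the set \<open>W\<close> of vertices outside \<open>L \<union> R\<close>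
  small. It is added to the side of \<open>R\<close>, at a cost of at most \<open>card S\<close>
  edges per vertex.\<close>

lemma almost_bipartition_of_carrier:
  assumes h: "vertex_cheeger G S > 0" "vertex_cheeger G S \<le> card S"
    and LR: "L \<subseteq> carrier G" "R \<subseteq> carrier G" "L \<inter> R = {}" "L \<union> R \<noteq> {}"
    and bound: "real (card (edges L L)) + card (edges R R)
      + card (edges (L \<union> R) (carrier G - (L \<union> R)))
      \<le> (vertex_cheeger G S)\<^sup>2 / (16 * real (card S) ^ 3) * card (L \<union> R)"
  shows "real (card (edges L L)) + card (edges (carrier G - L) (carrier G - L))
    \<le> vertex_cheeger G S * card (carrier G) / (8 * (real (card S))\<^sup>2)"
proof -
  define \<eta> where "\<eta> = vertex_cheeger G S"
  define D where "D = real (card S)"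
  define K where "K = \<eta>\<^sup>2 / (16 * D ^ 3)"
  define U where "U = L \<union> R"
  define W where "W = carrier G - U"
  define n where "n = real (card (carrier G))"
  note bnd = bound[folded \<eta>_def D_def, folded K_def U_def, folded W_def]
  have \<eta>: "\<eta> > 0" "\<eta> \<le> D" using h by (auto simp: \<eta>_def D_def)
  have D: "D \<ge> 1" using \<eta> by (auto simp: D_def)
  have Uc: "U \<subseteq> carrier G" "W \<subseteq> carrier G" "U \<noteq> {}" using LR by (auto simp: U_def W_def)
  have finU: "finite U" using Uc fin finite_subset by blast
  have Upos: "card U > 0" using finU Uc by (simp add: card_gt_0_iff)
  have Un: "card U \<le> n" unfolding n_def using Uc fin by (simp add: card_mono)
  have K_pos: "K \<ge> 0" using D by (simp add: K_def)
  have "K * (16 * D ^ 3) = \<eta> * \<eta>" using D by (simp add: K_def power2_eq_square)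
  also have "\<dots> \<le> \<eta> * D" using \<eta> by (intro mult_left_mono) auto
  also have "\<dots> < \<eta> * (16 * D ^ 3)"
  proof (rule mult_strict_left_mono)
    have "D * 1 \<le> D * D\<^sup>2" using D by (intro mult_left_mono) auto
    then show "D < 16 * D ^ 3" using D by (simp add: power3_eq_cube power2_eq_square)
  qed (use \<eta> in simp)
  finally have K_less: "K < \<eta>" using D by simp
  have cut: "\<eta> * min (card U) (card W) \<le> card (edges U W)"
    using cheeger_min_le_edges[OF Uc(1)] h(1) by (simp add: \<eta>_def W_def)
  \<comment> \<open>If \<open>U\<close> were the smaller side, at least
    \<open>\<eta> * card U\<close> edges would leave it, more than the \<open>K * card U\<close>
    allowed.\<close>
  have "\<not> card U \<le> card W"
  proof
    assume "card U \<le> card W"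
    then have "\<eta> * card U \<le> K * card U" using cut bnd by (simp add: min_def)
    then show False using K_less Upos by simp
  qed
  then have "\<eta> * card W \<le> card (edges U W)" using cut by (simp add: min_def split: if_splits)
  also have "\<dots> \<le> K * card U" using bnd by linarith
  also have "\<dots> \<le> K * n" using Un K_pos by (intro mult_left_mono) auto
  finally have W_le: "card W \<le> K * n / \<eta>" using \<eta> by (simp add: field_simps)
  have comp: "carrier G - L = R \<union> W" using LR by (auto simp: W_def U_def)
  have RW: "R \<inter> W = {}" by (auto simp: W_def U_def)
  have "card (edges (R \<union> W) (R \<union> W)) = card (edges R (R \<union> W)) + card (edges W (R \<union> W))"
    using LR Uc RW by (intro card_edges_Un_left) auto
  also have "card (edges R (R \<union> W)) = card (edges R R) + card (edges R W)"
    using LR Uc RW by (intro card_edges_Un) auto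
  \<comment> \<open>Pairs from \<open>R\<close> to \<open>W\<close> are charged to the edges leaving
    \<open>U\<close>, already part of the assumed bound; only pairs starting in \<open>W\<close>
    cost extra.\<close>
  also have "card (edges R W) \<le> card (edges U W)"
    using Uc by (intro card_mono finite_edges edges_mono) (auto simp: U_def)
  also have "card (edges W (R \<union> W)) \<le> card (edges W (carrier G))"
    using Uc LR by (intro card_mono finite_edges edges_mono) auto
  also have "\<dots> = card W * card S" using Uc(2) by (rule card_edges_carrier)
  finally have "card (edges (R \<union> W) (R \<union> W)) \<le> card (edges R R) + card (edges U W) + card W * card S"
    by simp
  then have "real (card (edges (R \<union> W) (R \<union> W)))
      \<le> real (card (edges R R) + card (edges U W) + card W * card S)" by (rule of_nat_mono)
  then have "real (card (edges L L)) + card (edges (R \<union> W) (R \<union> W)) \<le> K * card U + card W * D"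
    using bnd by (simp add: D_def)
  also have "\<dots> \<le> K * n + K * n / \<eta> * D"
    using Un K_pos W_le D by (intro add_mono mult_left_mono mult_right_mono) auto
  \<comment> \<open>Since \<open>D / \<eta>\<close> is at least 1, the second term dominates, and
    twice it is the claimed bound.\<close>
  also have "\<dots> \<le> K * n / \<eta> * D + K * n / \<eta> * D"
  proof -
    have "K * n * 1 \<le> K * n * (D / \<eta>)"
      using \<eta> K_pos by (intro mult_left_mono) (auto simp: n_def)
    then show ?thesis by (simp only: times_divide_eq_right times_divide_eq_left mult_1_right add_right_mono)
  qed
  also have "\<dots> = \<eta> * n / (8 * D\<^sup>2)"
    using \<eta> D by (simp add: K_def field_simps power2_eq_square power3_eq_cube)
  finally show ?thesis by (simp add: comp n_def \<eta>_def D_def)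
qed

text \<open>Displacements avoid a whole range: each is at most \<open>n / 16\<close> or at least
  \<open>27 / 64 * n\<close>. This gap turns approximate closure under products into exact
  closure.\<close>

lemma bipartite_of_almost_bipartition:
  assumes h: "vertex_cheeger G S > 0" "vertex_cheeger G S \<le> card S"
    and d: "card S \<ge> 2" and gen: "generate G S = carrier G"
    and X: "X \<subseteq> carrier G"
    and bound: "real (card (edges X X)) + card (edges (carrier G - X) (carrier G - X))
      \<le> vertex_cheeger G S * card (carrier G) / (8 * (real (card S))\<^sup>2)"
  shows "cayley_sum_bipartite G S"
proof -
  define Y where "Y = carrier G - X"
  define D where "D = real (card S)"
  define n where "n = real (card (carrier G))"
  define \<delta> where "\<delta> = vertex_cheeger G S * n / (8 * D\<^sup>2)"
  \<comment> \<open>The threshold of the dichotomy. The Cheeger constant cancels, and degree at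
    least 2 gives \<open>\<sigma> \<le> n / 16\<close>.\<close>
  define \<sigma> where "\<sigma> = 2 * \<delta> / vertex_cheeger G S"
  have D: "D \<ge> 2" using d by (simp add: D_def)
  then have D2: "D\<^sup>2 \<ge> 4" "D \<noteq> 0" using power_mono[of 2 D 2] by auto
  have "carrier G \<noteq> {}" by auto
  then have n: "n > 0" using fin by (simp add: n_def card_gt_0_iff)
  have \<sigma>_eq: "\<sigma> = n / (4 * D\<^sup>2)" using h by (simp add: \<sigma>_def \<delta>_def)
  have \<sigma>: "0 \<le> \<sigma>" "\<sigma> \<le> n / 16"
    using n D2 divide_left_mono[of 16 "4 * D\<^sup>2" n] by (auto simp: \<sigma>_eq)
  have "\<delta> \<le> D * n / (8 * D\<^sup>2)"
    unfolding \<delta>_def using h n by (intro divide_right_mono mult_right_mono) (auto simp: D_def)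
  then have \<delta>_D: "\<delta> \<le> n / (8 * D)" using D by (simp add: power2_eq_square)
  have \<delta>: "\<delta> \<le> n / 16"
    using \<delta>_D D n divide_left_mono[of 16 "8 * D" n] by simp
  have bnd: "real (card (edges X X)) + card (edges Y Y) \<le> \<delta>"
    using bound by (simp add: Y_def D_def n_def \<delta>_def)
  have Yc: "Y \<subseteq> carrier G" "X \<inter> Y = {}" "X \<union> Y = carrier G" using X by (auto simp: Y_def)
  have finXY: "finite X" "finite Y" using X Yc(1) fin by (auto intro: finite_subset)
  have XY: "real (card X) + card Y = n"
    using card_Un_disjoint[OF finXY Yc(2)] Yc(3) by (simp add: n_def)
  \<comment> \<open>Counting edge ends on each side and subtracting shows that \<open>X\<close> and
    \<open>Y\<close> have nearly equal size, by regularity.\<close>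
  have "card (edges X X) + card (edges X Y) = card X * card S"
    using card_edges_Un[OF X X Yc(1,2)] card_edges_carrier[OF X] Yc(3) by simp
  moreover have "card (edges X Y) + card (edges Y Y) = card Y * card S"
    using card_edges_Un[OF Yc(1) X Yc(1,2)] card_edges_carrier[OF Yc(1)] Yc(3)
      card_edges_commute[OF X Yc(1)] by simp
  ultimately have "real (card (edges X X)) + card (edges X Y) = card X * D"
      "real (card (edges X Y)) + card (edges Y Y) = card Y * D"
    unfolding D_def by (metis of_nat_add of_nat_mult)+
  then have "\<bar>real (card X) * D - real (card Y) * D\<bar> \<le> \<delta>" using bnd by linarith
  then have "\<bar>real (card X) - card Y\<bar> * D \<le> \<delta>"
    using D by (simp add: left_diff_distrib[symmetric] abs_mult)
  also have "\<delta> \<le> n / (8 * D\<^sup>2) * D" using \<delta>_D D by (simp add: power2_eq_square)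
  also have "\<dots> \<le> n / 32 * D"
    using D D2 n by (intro mult_right_mono divide_left_mono) auto
  finally have "\<bar>real (card X) - card Y\<bar> \<le> n / 32" using D by simp
  then have Xl: "real (card X) \<ge> 31 / 64 * n" "real (card Y) \<ge> 31 / 64 * n"
    using XY by linarith+

  define H where "H = {g\<in>carrier G. real (displacement X g) \<le> \<sigma>}"
  \<comment> \<open>The other alternative would give displacement at least
    \<open>31 / 64 * n - n / 16\<close>, above \<open>n / 8\<close>. The bound \<open>n / 8\<close>
    is twice \<open>n / 16\<close>, as needed for products of two elements.\<close>
  have HI: "g \<in> H" if "g \<in> carrier G" "real (displacement X g) \<le> n / 8" for g
    using displacement_dichotomy[OF X that(1) h(1) bnd[unfolded Y_def]] that Xl \<sigma> n
    by (auto simp: H_def \<sigma>_def[symmetric])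
  have notH: "real (displacement X g) \<ge> 27 / 64 * n" if "g \<in> carrier G - H" for g
    using displacement_dichotomy[OF X _ h(1) bnd[unfolded Y_def], of g] that Xl \<sigma>
    by (auto simp: H_def \<sigma>_def[symmetric])
  have sub: "subgroup H G"
  proof (rule subgroupI)
    show "H \<subseteq> carrier G" by (auto simp: H_def)
    have "\<one> \<in> H" using \<sigma> by (simp add: H_def displacement_one[OF X])
    then show "H \<noteq> {}" by auto
    show "inv g \<in> H" if "g \<in> H" for g using that by (simp add: H_def displacement_inv[OF X])
    show "g \<otimes> k \<in> H" if gk: "g \<in> H" "k \<in> H" for g k
    proof (rule HI)
      have gc: "g \<in> carrier G" "k \<in> carrier G" using gk by (auto simp: H_def)
      then show "g \<otimes> k \<in> carrier G" by simp
      have "real (displacement X (g \<otimes> k)) \<le> real (displacement X g + displacement X k)"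
        using displacement_mult[OF X gc] by (rule of_nat_mono)
      then show "real (displacement X (g \<otimes> k)) \<le> n / 8" using gk \<sigma> by (auto simp: H_def)
    qed
  qed
  have SS: "s \<otimes> t \<in> H" if st: "s \<in> S" "t \<in> S" for s t
  proof (rule HI)
    show "s \<otimes> t \<in> carrier G" using st S_carrier by auto
    have "real (displacement X (s \<otimes> t)) \<le> real (card (edges X X) + card (edges Y Y))"
      unfolding Y_def using displacement_mult_S[OF X st] by (rule of_nat_mono)
    then show "real (displacement X (s \<otimes> t)) \<le> n / 8" using bnd \<delta> n by simp
  qed
  have Hc: "H \<subseteq> carrier G" by (auto simp: H_def)
  have total: "(\<Sum>g\<in>carrier G. real (displacement X g)) = real (card X) * card Y"
    using sum_displacement[OF X] by (metis Y_def of_nat_mult of_nat_sum)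
  \<comment> \<open>Otherwise the average displacement is at most \<open>n / 16\<close>, while
    double counting gives at least \<open>(31 / 64)\<^sup>2 * n\<close>.\<close>
  have "H \<noteq> carrier G"
  proof
    assume "H = carrier G"
    then have "(\<Sum>g\<in>carrier G. real (displacement X g)) \<le> (\<Sum>g\<in>carrier G. n / 16)"
      using \<sigma> by (intro sum_mono) (force simp: H_def)
    then have "real (card X) * card Y \<le> n * n / 16" by (simp add: total n_def)
    moreover have "(31 / 64 * n) * (31 / 64 * n) \<le> real (card X) * card Y"
      using Xl n by (intro mult_mono) auto
    moreover have "n * n > 0" using n by simp
    ultimately show False by (simp add: algebra_simps)
  qed
  \<comment> \<open>Otherwise two thirds of the group have displacement at least
    \<open>27 / 64 * n\<close>, a total of \<open>9 / 32 * n\<^sup>2\<close>, above the maximum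
    \<open>n\<^sup>2 / 4\<close> of \<open>card X * card Y\<close>.\<close>
  moreover have "card (carrier G) < 3 * card H"
  proof (rule ccontr)
    assume "\<not> ?thesis"
    then have "real (3 * card H) \<le> n" unfolding n_def by (intro of_nat_mono) simp
    moreover have "real (card (carrier G - H)) = n - card H"
      unfolding n_def using fin Hc by (simp add: card_Diff_subset finite_subset card_mono of_nat_diff)
    ultimately have "2 / 3 * n * (27 / 64 * n) \<le> card (carrier G - H) * (27 / 64 * n)"
      using n by (intro mult_right_mono) auto
    also have "\<dots> = (\<Sum>g\<in>carrier G - H. 27 / 64 * n)" by simp
    also have "\<dots> \<le> (\<Sum>g\<in>carrier G - H. real (displacement X g))"
      by (intro sum_mono notH)
    also have "\<dots> \<le> (\<Sum>g\<in>carrier G. real (displacement X g))"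
      using fin by (intro sum_mono2) auto
    also have "\<dots> = real (card X) * card Y" by (rule total)
    also have "4 * (real (card X) * card Y) \<le> (real (card X) + card Y)\<^sup>2"
      using sum_squares_bound[of "real (card X)" "real (card Y)"] by (simp add: power2_sum)
    finally have "4 * (2 / 3 * n * (27 / 64 * n)) \<le> n * n"
      unfolding XY by (simp add: power2_eq_square)
    moreover have "n * n > 0" using n by simp
    ultimately show False by (simp add: algebra_simps)
  qed
  ultimately show ?thesis using bipartite_of_subgroup[OF sub _ _ gen SS] by blast
qed

lemma adj_sum_eq_card_edges:
  assumes "A \<subseteq> carrier G" "B \<subseteq> carrier G"
  shows "(\<Sum>x\<in>A. \<Sum>y\<in>B. if cayley_sum_adj G S x y then 1 else 0) = real (card (edges A B))"
proof -
  have "finite B" using assms(2) fin finite_subset by blast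
  then show ?thesis
    by (simp add: card_edges_sum[OF assms] cayley_sum_adj_def sum.If_cases Int_def)
qed

lemma adj_eigenvalue_gt:
  assumes gen: "generate G S = carrier G" and one: "\<one> \<notin> S"
    and exp: "is_expander G S" and nb: "\<not> cayley_sum_bipartite G S"
    and ev: "\<And>x. x \<in> carrier G \<Longrightarrow>
      (\<Sum>y\<in>carrier G. (if cayley_sum_adj G S x y then 1 else 0) * f y) = real (card S) * t * f x"
    and nz: "\<exists>x\<in>carrier G. f x \<noteq> 0"
  shows "- 1 + vertex_cheeger G S ^ 4 / (2 ^ 9 * real (card S) ^ 8) < t"
proof (rule ccontr)
  assume "\<not> ?thesis"
  then have t: "1 + t \<le> vertex_cheeger G S ^ 4 / (2 ^ 9 * real (card S) ^ 8)" by simp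
  \<comment> \<open>Chosen so that \<open>\<beta>\<^sup>2 / 2\<close> is the spectral gap to be
    refuted; \<open>\<beta> * card S\<close> is then the edge density required by
    \<open>almost_bipartition_of_carrier\<close>.\<close>
  define \<beta> where "\<beta> = (vertex_cheeger G S)\<^sup>2 / (16 * real (card S) ^ 4)"
  have d: "card S \<ge> 2" by (rule card_S_ge_2[OF gen one nb])
  have h: "vertex_cheeger G S > 0" using exp by (auto simp: is_expander_def)
  have "card S \<le> card (carrier G)" using fin S_carrier by (rule card_mono)
  then have hd: "vertex_cheeger G S \<le> card S" using d by (intro cheeger_le_degree) simp
  have \<beta>: "\<beta> > 0" using h d by (simp add: \<beta>_def)
  have "\<beta>\<^sup>2 / 2 = vertex_cheeger G S ^ 4 / (2 ^ 9 * real (card S) ^ 8)"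
    by (simp add: \<beta>_def power_divide power_mult_distrib flip: power_mult)
  then have \<beta>t: "1 + t \<le> \<beta>\<^sup>2 / 2" using t by simp
  have "\<exists>L R. L \<subseteq> carrier G \<and> R \<subseteq> carrier G \<and> L \<inter> R = {} \<and> L \<union> R \<noteq> {} \<and>
    (\<Sum>x\<in>L. \<Sum>y\<in>L. if cayley_sum_adj G S x y then 1 else 0)
    + (\<Sum>x\<in>R. \<Sum>y\<in>R. if cayley_sum_adj G S x y then 1 else 0)
    + (\<Sum>x\<in>L \<union> R. \<Sum>y\<in>carrier G - (L \<union> R). if cayley_sum_adj G S x y then 1 else 0)
    \<le> \<beta> * real (card S) * real (card (L \<union> R))"
  proof (rule exists_almost_bipartition[OF fin _ _ _ ev nz \<beta> \<beta>t])
    show "(if cayley_sum_adj G S x y then 1 else 0) = (if cayley_sum_adj G S y x then 1 else (0::real))"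
      if "x \<in> carrier G" "y \<in> carrier G" for x y
      using that mult_mem_S_commute by (auto simp: cayley_sum_adj_def)
    show "(\<Sum>y\<in>carrier G. if cayley_sum_adj G S x y then 1 else 0) = real (card S)"
      if "x \<in> carrier G" for x
      using card_nbrs[OF that] fin by (simp add: cayley_sum_adj_def sum.If_cases Int_def)
  qed auto
  then obtain L R where LR: "L \<subseteq> carrier G" "R \<subseteq> carrier G" "L \<inter> R = {}" "L \<union> R \<noteq> {}"
    and b: "(\<Sum>x\<in>L. \<Sum>y\<in>L. if cayley_sum_adj G S x y then 1 else 0)
    + (\<Sum>x\<in>R. \<Sum>y\<in>R. if cayley_sum_adj G S x y then 1 else 0)
    + (\<Sum>x\<in>L \<union> R. \<Sum>y\<in>carrier G - (L \<union> R). if cayley_sum_adj G S x y then 1 else 0)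
    \<le> \<beta> * real (card S) * real (card (L \<union> R))" by blast
  have "\<beta> * real (card S) = (vertex_cheeger G S)\<^sup>2 / (16 * real (card S) ^ 3)"
    using d by (simp add: \<beta>_def field_simps eval_nat_numeral)
  then have "real (card (edges L L)) + card (edges R R)
      + card (edges (L \<union> R) (carrier G - (L \<union> R)))
      \<le> (vertex_cheeger G S)\<^sup>2 / (16 * real (card S) ^ 3) * card (L \<union> R)"
    using b LR by (simp add: adj_sum_eq_card_edges)
  from almost_bipartition_of_carrier[OF h hd LR this]
  have "cayley_sum_bipartite G S" by (rule bipartite_of_almost_bipartition[OF h hd d gen LR(1)])
  with nb show False by simp
qed

section \<open>Transfer between matrices and functions on the group\<close>

context
  fixes vs :: "'a list"
  assumes vs: "distinct vs" "set vs = carrier G"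
begin

lemma norm_adj_matrix_mult_index:
  assumes "v \<in> carrier_vec (length vs)" "i < length vs"
  shows "(norm_adj_matrix G S vs *\<^sub>v v) $ i =
    (\<Sum>j<length vs. (if cayley_sum_adj G S (vs ! i) (vs ! j) then 1 else 0) * v $ j) / card S"
proof -
  have "(norm_adj_matrix G S vs *\<^sub>v v) $ i = (\<Sum>j<length vs. norm_adj_matrix G S vs $$ (i, j) * v $ j)"
    using assms by (simp add: norm_adj_matrix_def adj_matrix_def scalar_prod_def lessThan_atLeast0)
  also have "\<dots> = (\<Sum>j<length vs.
      (if cayley_sum_adj G S (vs ! i) (vs ! j) then 1 else 0) * v $ j / card S)"
    using assms(2) by (intro sum.cong) (auto simp: norm_adj_matrix_def adj_matrix_def)
  finally show ?thesis by (simp only: sum_divide_distrib)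
qed

lemma sum_nth_eq_sum_carrier: "(\<Sum>j<length vs. F (vs ! j)) = (\<Sum>y\<in>carrier G. F y)"
  using sum.reindex_bij_betw[OF bij_betw_nth[OF vs(1) refl vs(2)[symmetric]], of F] .

lemma norm_adj_matrix_eigenvalueD:
  assumes "eigenvalue (norm_adj_matrix G S vs) t" "card S > 0"
  shows "\<exists>f. (\<exists>x\<in>carrier G. f x \<noteq> 0) \<and> (\<forall>x\<in>carrier G.
    (\<Sum>y\<in>carrier G. (if cayley_sum_adj G S x y then 1 else 0) * f y) = real (card S) * t * f x)"
proof -
  from assms obtain v where v: "v \<in> carrier_vec (length vs)" "v \<noteq> 0\<^sub>v (length vs)"
    "norm_adj_matrix G S vs *\<^sub>v v = t \<cdot>\<^sub>v v"
    by (auto simp: eigenvalue_def eigenvector_def norm_adj_matrix_def adj_matrix_def)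
  have bij: "bij_betw ((!) vs) {..<length vs} (carrier G)"
    using bij_betw_nth[OF vs(1) refl vs(2)[symmetric]] .
  \<comment> \<open>The enumeration is a bijection onto the group, so each vertex has one index at
    which to read off the vector.\<close>
  define f where "f x = v $ (inv_into {..<length vs} ((!) vs) x)" for x
  have f: "f (vs ! j) = v $ j" if "j < length vs" for j
    using bij that by (simp add: f_def bij_betw_inv_into_left)
  obtain i where "i < length vs" "v $ i \<noteq> 0" using v(1,2) by (metis carrier_vecD eq_vecI index_zero_vec)
  then have "\<exists>x\<in>carrier G. f x \<noteq> 0" using f vs(2) by (metis nth_mem)
  moreover have "(\<Sum>y\<in>carrier G. (if cayley_sum_adj G S x y then 1 else 0) * f y) = real (card S) * t * f x"
    if x: "x \<in> carrier G" for x
  proof -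
    obtain i where i: "i < length vs" "vs ! i = x" using x vs(2) by (metis in_set_conv_nth)
    have "(\<Sum>y\<in>carrier G. (if cayley_sum_adj G S x y then 1 else 0) * f y)
        = (\<Sum>j<length vs. (if cayley_sum_adj G S (vs ! i) (vs ! j) then 1 else 0) * f (vs ! j))"
      using sum_nth_eq_sum_carrier[of "\<lambda>y. (if cayley_sum_adj G S x y then 1 else 0) * f y"]
      unfolding i(2) by (rule sym)
    also have "\<dots> = (\<Sum>j<length vs. (if cayley_sum_adj G S (vs ! i) (vs ! j) then 1 else 0) * v $ j)"
      by (intro sum.cong refl arg_cong2[of _ _ _ _ "(*)"] f) simp
    also have "\<dots> = real (card S) * (norm_adj_matrix G S vs *\<^sub>v v) $ i"
      unfolding norm_adj_matrix_mult_index[OF v(1) i(1)] using assms(2) by simp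
    also have "\<dots> = real (card S) * (t * v $ i)" unfolding v(3) using v(1) i(1) by simp
    also have "\<dots> = real (card S) * t * f x" using f[OF i(1)] i(2) by simp
    finally show ?thesis .
  qed
  ultimately show ?thesis by blast
qed

text \<open>By regularity the constant vector is an eigenvector. This makes the spectrum nonempty,
  so that its minimum is a genuine eigenvalue.\<close>

lemma norm_adj_matrix_eigenvalue_one:
  assumes "card S > 0"
  shows "eigenvalue (norm_adj_matrix G S vs) 1"
proof -
  let ?v = "vec (length vs) (\<lambda>_. 1 :: real)"
  have dim: "dim_row (norm_adj_matrix G S vs) = length vs"
    by (simp add: norm_adj_matrix_def adj_matrix_def)
  have "(norm_adj_matrix G S vs *\<^sub>v ?v) $ i = 1" if i: "i < length vs" for i
  proof -
    have vi: "vs ! i \<in> carrier G" using i vs(2) nth_mem by blast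
    have "(\<Sum>j<length vs. (if cayley_sum_adj G S (vs ! i) (vs ! j) then 1 else 0) * ?v $ j)
      = (\<Sum>j<length vs. if cayley_sum_adj G S (vs ! i) (vs ! j) then 1 else 0)"
      by (intro sum.cong) auto
    also have "\<dots> = (\<Sum>y\<in>carrier G. if cayley_sum_adj G S (vs ! i) y then 1 else 0)"
      by (rule sum_nth_eq_sum_carrier)
    also have "\<dots> = real (card S)"
      using card_nbrs[OF vi] fin by (simp add: cayley_sum_adj_def sum.If_cases Int_def)
    finally show ?thesis using i assms by (simp add: norm_adj_matrix_mult_index)
  qed
  then have "norm_adj_matrix G S vs *\<^sub>v ?v = 1 \<cdot>\<^sub>v ?v"
    using dim by (intro eq_vecI) auto
  moreover have "?v \<noteq> 0\<^sub>v (length vs)"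
  proof -
    have "length vs > 0" using vs(2) one_closed by (metis length_pos_if_in_set)
    then have "?v $ 0 \<noteq> 0\<^sub>v (length vs) $ 0" by simp
    then show ?thesis by metis
  qed
  ultimately show ?thesis
    unfolding eigenvalue_def eigenvector_def dim by (intro exI[of _ ?v]) simp
qed

lemma eigenvalue_norm_laplacian_iff:
  "eigenvalue (norm_laplacian G S vs) k \<longleftrightarrow> eigenvalue (norm_adj_matrix G S vs) (1 - k)"
proof -
  have A: "norm_adj_matrix G S vs \<in> carrier_mat (length vs) (length vs)"
    by (simp add: norm_adj_matrix_def adj_matrix_def)
  have "norm_laplacian G S vs *\<^sub>v v = k \<cdot>\<^sub>v v \<longleftrightarrow> norm_adj_matrix G S vs *\<^sub>v v = (1 - k) \<cdot>\<^sub>v v"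
    if v: "v \<in> carrier_vec (length vs)" for v
  proof -
    define w where "w = norm_adj_matrix G S vs *\<^sub>v v"
    have w: "dim_vec w = length vs" using A by (simp add: w_def)
    have "norm_laplacian G S vs *\<^sub>v v = v - w"
      unfolding norm_laplacian_def w_def
      using minus_mult_distrib_mat_vec[OF one_carrier_mat A v] v by simp
    moreover have "v - w = k \<cdot>\<^sub>v v \<longleftrightarrow> w = (1 - k) \<cdot>\<^sub>v v"
      using v w by (auto simp: vec_eq_iff left_diff_distrib)
    ultimately show ?thesis by (simp add: w_def)
  qed
  then show ?thesis using A unfolding eigenvalue_def eigenvector_def norm_laplacian_def by auto
qed

end

end

theorem theorem1p3:
  fixes G :: "('a, 'b) monoid_scheme" (structure)
    and S :: "'a set" and d :: nat and vs :: "'a list"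
  assumes "group G"
    and "finite (carrier G)"
    and "S \<subseteq> carrier G"
    and "(\<lambda>s. inv s) ` S = S"
    and "generate G S = carrier G"
    and "\<one> \<notin> S"
    and "\<forall>g\<in>carrier G. \<forall>s\<in>S. g \<otimes> s \<otimes> inv g \<in> S"
    and "card S = d"
    and "distinct vs" and "set vs = carrier G"
    and "is_expander G S"
    and "\<not> cayley_sum_bipartite G S"
  shows "largest_eigenvalue (norm_laplacian G S vs)
           < 2 - vertex_cheeger G S ^ 4 / (2 ^ 9 * real d ^ 8)
       \<and> - 1 + vertex_cheeger G S ^ 4 / (2 ^ 9 * real d ^ 8)
           < smallest_eigenvalue (norm_adj_matrix G S vs)"
proof -
  interpret group G by fact
  interpret cayley_sum_graph G S using assms by unfold_locales auto
  let ?A = "norm_adj_matrix G S vs" and ?L = "norm_laplacian G S vs"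
  let ?c = "vertex_cheeger G S ^ 4 / (2 ^ 9 * real d ^ 8)"
  have d: "card S > 0" using card_S_ge_2[OF assms(5,6,12)] by simp
  have dims: "?A \<in> carrier_mat (length vs) (length vs)" "?L \<in> carrier_mat (length vs) (length vs)"
    by (auto simp: norm_adj_matrix_def adj_matrix_def norm_laplacian_def)
  have gt: "- 1 + ?c < t" if ev: "eigenvalue ?A t" for t
  proof -
    obtain f where "\<exists>x\<in>carrier G. f x \<noteq> 0" "\<forall>x\<in>carrier G.
      (\<Sum>y\<in>carrier G. (if cayley_sum_adj G S x y then 1 else 0) * f y) = real (card S) * t * f x"
      using norm_adj_matrix_eigenvalueD[OF assms(9,10) ev d] by blast
    then show ?thesis using adj_eigenvalue_gt[OF assms(5,6,11,12), of f t] assms(8) by simp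
  qed
  have one: "eigenvalue ?A 1" by (rule norm_adj_matrix_eigenvalue_one[OF assms(9,10) d])
  then have "smallest_eigenvalue ?A \<in> spectrum ?A" unfolding smallest_eigenvalue_def
    by (intro Min_in card_finite_spectrum(1)[OF dims(1)]) (auto simp: spectrum_def)
  then have "- 1 + ?c < smallest_eigenvalue ?A" using gt by (simp add: spectrum_def)
  \<comment> \<open>The eigenvalue 1 of \<open>?A\<close> becomes the eigenvalue 0 of
    \<open>?L\<close>, so this maximum too is over a nonempty set.\<close>
  moreover have "largest_eigenvalue ?L \<in> spectrum ?L" unfolding largest_eigenvalue_def
    using one eigenvalue_norm_laplacian_iff[OF assms(9,10), of 0]
    by (intro Max_in card_finite_spectrum(1)[OF dims(2)]) (auto simp: spectrum_def)
  then have "eigenvalue ?A (1 - largest_eigenvalue ?L)"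
    using eigenvalue_norm_laplacian_iff[OF assms(9,10)] by (simp add: spectrum_def)
  then have "largest_eigenvalue ?L < 2 - ?c" using gt by fastforce
  ultimately show ?thesis by simp
qed

end
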